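(* Let $G$ be a connected bipartite simple graph with set of nodes $X$, equipped with a topology $\tau$ on $X$. Then, for every two open non-empty subsets $U$ and $V$ of $X$, we have $$S(U,V)=L(U,V):=\{d(u,v)+2k : u\in U,\ v\in V,\ k\in\mathbb N_0\}\cap\mathbb N$$ and $$\mathrm S_{G,\tau}\leq \mathrm S_G\leq d(G)+\frac{(d(G))^2}{4}-\frac14\chi_{2\mathbb N+1}(d(G)).$$
   Context: $\mathbb N=\{1,2,\dots\}$, $\mathbb N_0=\mathbb N\cup\{0\}$. A simple graph is a finite set $X$ with $|X|>1$ together with a symmetric relation $\rho\subseteq X\times X$ such that $(x,x)\notin\rho$ for all $x$. $d(u,v)$ is the graph distance (with $d(u,u)=0$) and $d(G)$ is the diameter of $G$. For $U,V\subseteq X$ non-empty, $S(U,V):=\{n\in\mathbb N:\rho^n(U)\cap V\neq\emptyset\}$, where $\rho^n$ is the $n$-fold composition of $\rho$ and $\rho^n(U)=\{y:(x,y)\in\rho^n\text{ for some }x\in U\}$; that is, $n\in S(U,V)$ iff there is a walk of length $n$ from some node of $U$ to some node of $V$. $\mathrm S_{G,\tau}$ denotes the cardinality of the set $\{S(U,V): U,V\subseteq X\text{ non-empty and }\tau\text{-open}\}$, and $\mathrm S_G$ denotes $\mathrm S_{G,\tau}$ for the discrete topology $\tau$. $\chi_A$ denotes the characteristic function of $A$.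
   Formalization: The last inequality is claimed only for d(G) ≠ 1: the only excluded graph is the single edge on two nodes, where S_G = 3 exceeds the stated bound 5/4, so the printed inequality fails there. *)

theory Defs
  imports "HOL-Analysis.Analysis"
begin

definition simple_graph :: "'a set \<Rightarrow> ('a \<times> 'a) set \<Rightarrow> bool" where
  "simple_graph X \<rho> \<longleftrightarrow>
     finite X \<and> card X > 1 \<and> \<rho> \<subseteq> X \<times> X \<and> sym \<rho> \<and> (\<forall>x. (x, x) \<notin> \<rho>)"

definition connected_graph :: "'a set \<Rightarrow> ('a \<times> 'a) set \<Rightarrow> bool" where
  "connected_graph X \<rho> \<longleftrightarrow> (\<forall>u\<in>X. \<forall>v\<in>X. (u, v) \<in> \<rho>\<^sup>*)"

definition bipartite_graph :: "'a set \<Rightarrow> ('a \<times> 'a) set \<Rightarrow> bool" where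
  "bipartite_graph X \<rho> \<longleftrightarrow>
     (\<exists>A B. A \<union> B = X \<and> A \<inter> B = {} \<and> \<rho> \<subseteq> A \<times> B \<union> B \<times> A)"

text \<open>A pair lies in \<open>\<rho> ^^ n\<close> iff it is joined by a walk of length \<open>n\<close>, so the shortest such
  \<open>n\<close> is the graph distance. It is meaningful only for nodes joined by some walk.\<close>

definition graph_dist :: "('a \<times> 'a) set \<Rightarrow> 'a \<Rightarrow> 'a \<Rightarrow> nat" where
  "graph_dist \<rho> u v = (LEAST n. (u, v) \<in> \<rho> ^^ n)"

definition graph_diameter :: "'a set \<Rightarrow> ('a \<times> 'a) set \<Rightarrow> nat" where
  "graph_diameter X \<rho> = Max {graph_dist \<rho> u v | u v. u \<in> X \<and> v \<in> X}"

text \<open>The set \<open>S(U,V)\<close> of positive lengths of walks from \<open>U\<close> to \<open>V\<close>.\<close>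

definition walk_lengths :: "('a \<times> 'a) set \<Rightarrow> 'a set \<Rightarrow> 'a set \<Rightarrow> nat set" where
  "walk_lengths \<rho> U V = {n. n \<ge> 1 \<and> (\<rho> ^^ n) `` U \<inter> V \<noteq> {}}"

text \<open>The set \<open>L(U,V)\<close>; intersecting with \<open>{1..}\<close> removes the value \<open>0\<close> that arises when
  \<open>U\<close> and \<open>V\<close> meet.\<close>

definition dist_lengths :: "('a \<times> 'a) set \<Rightarrow> 'a set \<Rightarrow> 'a set \<Rightarrow> nat set" where
  "dist_lengths \<rho> U V =
     {graph_dist \<rho> u v + 2 * k | u v k. u \<in> U \<and> v \<in> V} \<inter> {1..}"

text \<open>The number \<open>S\<^sub>G\<^sub>,\<^sub>\<tau>\<close>; the node set is \<open>topspace \<tau>\<close>. The number \<open>S\<^sub>G\<close> is the instance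
  \<open>\<tau> = discrete_topology X\<close>.\<close>

definition S_number :: "('a \<times> 'a) set \<Rightarrow> 'a topology \<Rightarrow> nat" where
  "S_number \<rho> \<tau> =
     card {walk_lengths \<rho> U V | U V. openin \<tau> U \<and> U \<noteq> {} \<and> openin \<tau> V \<and> V \<noteq> {}}"

end

(* Bipartiteness forces all walks between two given nodes to have the same parity, and walking back
   and forth along an edge lengthens a walk by 2; hence S(U,V) = L(U,V). Such a set is determined by
   its least even and its least odd element, at least one of which exists. If d(G) is at least 2, both
   lie in {1..d(G)} (the distance 0 contributes the element 2). There are d(G) choices with one
   parity only and floor(d/2) * ceil(d/2) choices with both. *)

theory Submission
  imports Defs
begin

section \<open>Unions of arithmetic progressions with difference 2\<close>

definition progression2 :: "nat \<Rightarrow> nat set" where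
  "progression2 m = {m + 2 * k | k. True}"

text \<open>Progressions whose starting points have the same parity are nested, so the one with the
  least start absorbs all the others.\<close>

lemma Union_progression2_same_parity:
  assumes "finite M" "M \<noteq> {}" and par: "\<And>m n. m \<in> M \<Longrightarrow> n \<in> M \<Longrightarrow> even m = even n"
  shows "(\<Union>m\<in>M. progression2 m) = progression2 (Min M)"
proof (intro equalityI subsetI)
  have Min: "Min M \<in> M" using assms by simp
  then show "n \<in> (\<Union>m\<in>M. progression2 m)" if "n \<in> progression2 (Min M)" for n
    using that by blast
  fix n assume "n \<in> (\<Union>m\<in>M. progression2 m)"
  then obtain m k where m: "m \<in> M" and n: "n = m + 2 * k" by (auto simp: progression2_def)
  have "Min M \<le> m" using m assms by simp
  then obtain j where j: "m = Min M + j" using le_Suc_ex by blast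
  with par[OF m Min] have "even j" by presburger
  then obtain i where "j = 2 * i" by (elim evenE)
  with n j have "n = Min M + 2 * (i + k)" by simp
  then show "n \<in> progression2 (Min M)" unfolding progression2_def by blast
qed

text \<open>Splitting \<open>M\<close> by parity leaves one progression for each non-empty half. The
  first image covers a single parity; the pairs cover mixed parity, with components running over the
  even and the odd numbers in \<open>{1..D}\<close>.\<close>

lemma Union_progression2_cases:
  assumes M: "M \<subseteq> {1..D}" "M \<noteq> {}"
  shows "(\<Union>m\<in>M. progression2 m) \<in> progression2 ` {1..D} \<union>
    (\<lambda>(a, b). progression2 a \<union> progression2 b) `
      ((\<lambda>i. 2 * i) ` {1..D div 2} \<times> (\<lambda>i. 2 * i + 1) ` {..<(D + 1) div 2})"
proof -
  have fin: "finite M" using M finite_subset by blast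
  define E where "E = {m\<in>M. even m}"
  define F where "F = {m\<in>M. odd m}"
  have EF: "M = E \<union> F" "finite E" "finite F" using fin by (auto simp: E_def F_def)
  have E: "(\<Union>m\<in>E. progression2 m) = progression2 (Min E)" if "E \<noteq> {}"
    using that EF(2,3) by (intro Union_progression2_same_parity) (auto simp: E_def)
  have F: "(\<Union>m\<in>F. progression2 m) = progression2 (Min F)" if "F \<noteq> {}"
    using that EF(2,3) by (intro Union_progression2_same_parity) (auto simp: F_def)
  consider "F = {}" "E \<noteq> {}" | "E = {}" "F \<noteq> {}" | "E \<noteq> {}" "F \<noteq> {}"
    using M EF by blast
  then show ?thesis
  proof cases
    case 1
    have "Min E \<in> {1..D}" using Min_in[OF EF(2) 1(2)] EF(1) M by blast
    then show ?thesis using E 1 EF(1) by simp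
  next
    case 2
    have "Min F \<in> {1..D}" using Min_in[OF EF(3) 2(2)] EF(1) M by blast
    then show ?thesis using F 2 EF(1) by simp
  next
    case 3
    have eE: "even (Min E)" "Min E \<in> {1..D}"
      using Min_in[OF EF(2) 3(1)] M by (auto simp: E_def)
    have oF: "odd (Min F)" "Min F \<in> {1..D}"
      using Min_in[OF EF(3) 3(2)] M by (auto simp: F_def)
    obtain i where i: "Min E = 2 * i" using eE by (elim evenE)
    obtain j where j: "Min F = 2 * j + 1" using oF by (elim oddE)
    have "Min E \<in> (\<lambda>i. 2 * i) ` {1..D div 2}" using i eE by auto
    moreover have "Min F \<in> (\<lambda>i. 2 * i + 1) ` {..<(D + 1) div 2}" using j oF by auto
    moreover have "(\<Union>m\<in>M. progression2 m) = progression2 (Min E) \<union> progression2 (Min F)"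
      using E F 3 EF(1) by (simp add: UN_Un)
    ultimately show ?thesis by (intro UnI2 image_eqI[of _ _ "(Min E, Min F)"]) simp_all
  qed
qed

text \<open>There are \<open>D div 2\<close> even and \<open>(D + 1) div 2\<close> odd numbers in
  \<open>{1..D}\<close>. Mixed parity contributes at most their product, a single parity at most
  \<open>D\<close>.\<close>

lemma card_Union_progression2_le:
  assumes "\<And>W. W \<in> \<W> \<Longrightarrow> \<exists>M \<subseteq> {1..D}. M \<noteq> {} \<and> W = (\<Union>m\<in>M. progression2 m)"
  shows "card \<W> \<le> D + (D div 2) * ((D + 1) div 2)"
proof -
  let ?P = "(\<lambda>i. 2 * i) ` {1..D div 2}" and ?Q = "(\<lambda>i. 2 * i + 1) ` {..<(D + 1) div 2}"
  let ?f = "\<lambda>(a, b). progression2 a \<union> progression2 b"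
  have "\<W> \<subseteq> progression2 ` {1..D} \<union> ?f ` (?P \<times> ?Q)"
  proof
    fix W assume "W \<in> \<W>"
    then obtain M where M: "M \<subseteq> {1..D}" "M \<noteq> {}" and W: "W = (\<Union>m\<in>M. progression2 m)"
      using assms by meson
    show "W \<in> progression2 ` {1..D} \<union> ?f ` (?P \<times> ?Q)"
      unfolding W using M by (rule Union_progression2_cases)
  qed
  then have "card \<W> \<le> card (progression2 ` {1..D} \<union> ?f ` (?P \<times> ?Q))"
    by (intro card_mono) auto
  also have "\<dots> \<le> card (progression2 ` {1..D}) + card (?f ` (?P \<times> ?Q))"
    by (rule card_Un_le)
  also have "\<dots> \<le> card {1..D} + card (?P \<times> ?Q)"
    by (intro add_mono card_image_le) auto
  also have "card (?P \<times> ?Q) \<le> card {1..D div 2} * card {..<(D + 1) div 2}"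
    unfolding card_cartesian_product by (intro mult_mono card_image_le) auto
  finally show ?thesis by simp
qed

section \<open>Walks, distances and the diameter\<close>

text \<open>Every edge switches sides, so the sides of the two end nodes fix the parity of the
  length of any walk between them.\<close>

lemma relpow_bipartite_parity:
  assumes "A \<inter> B = {}" "\<rho> \<subseteq> A \<times> B \<union> B \<times> A" "u \<in> A \<union> B" "(u, v) \<in> \<rho> ^^ n"
  shows "even n \<longleftrightarrow> (u \<in> A \<longleftrightarrow> v \<in> A)"
  using assms(4)
proof (induction n arbitrary: v)
  case (Suc n)
  then obtain w where w: "(u, w) \<in> \<rho> ^^ n" "(w, v) \<in> \<rho>" by auto
  have "w \<in> A \<longleftrightarrow> v \<notin> A" using w(2) assms(1,2) by blast
  then show ?case using Suc.IH[OF w(1)] by auto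
qed auto

text \<open>The extra steps go from \<open>v\<close> to its neighbour \<open>w\<close> and back,
  \<open>k\<close> times.\<close>

lemma relpow_add_even:
  assumes "sym \<rho>" "(v, w) \<in> \<rho>" "(u, v) \<in> \<rho> ^^ n"
  shows "(u, v) \<in> \<rho> ^^ (n + 2 * k)"
proof (induction k)
  case (Suc k)
  have "(u, w) \<in> \<rho> ^^ Suc (n + 2 * k)" using Suc assms(2) by (rule relpow_Suc_I)
  then have "(u, v) \<in> \<rho> ^^ Suc (Suc (n + 2 * k))"
    using symD[OF assms(1,2)] by (rule relpow_Suc_I)
  then show ?case by simp
qed (use assms in simp)

text \<open>Reachability supplies some walk length, so the \<open>LEAST\<close> in the definition of
  the distance is attained.\<close>

lemma relpow_graph_dist:
  assumes "(u, v) \<in> \<rho>\<^sup>*"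
  shows "(u, v) \<in> \<rho> ^^ graph_dist \<rho> u v"
proof -
  obtain n where "(u, v) \<in> \<rho> ^^ n" using assms rtrancl_imp_relpow by blast
  then show ?thesis unfolding graph_dist_def by (rule LeastI)
qed

lemma graph_dist_le: "(u, v) \<in> \<rho> ^^ n \<Longrightarrow> graph_dist \<rho> u v \<le> n"
  unfolding graph_dist_def by (rule Least_le)

lemma graph_dist_le_diameter:
  assumes "finite X" "u \<in> X" "v \<in> X"
  shows "graph_dist \<rho> u v \<le> graph_diameter X \<rho>"
proof -
  have "finite ((\<lambda>(u, v). graph_dist \<rho> u v) ` (X \<times> X))" using assms(1) by simp
  then have "finite {graph_dist \<rho> u v | u v. u \<in> X \<and> v \<in> X}"
    by (rule rev_finite_subset) auto
  then show ?thesis unfolding graph_diameter_def using assms(2,3) by (intro Max_ge) auto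
qed

text \<open>Since \<open>card X > 1\<close> there is a node other than \<open>v\<close>, and the
  first step of a walk towards it is the required edge. This edge is what walks ending in
  \<open>v\<close> are prolonged along.\<close>

lemma connected_graph_neighbour:
  assumes "simple_graph X \<rho>" "connected_graph X \<rho>" "v \<in> X"
  obtains w where "(v, w) \<in> \<rho>"
proof -
  have "\<not> X \<subseteq> {v}" using assms(1) card_mono[of "{v}" X] by (auto simp: simple_graph_def)
  then obtain x where "x \<in> X" "x \<noteq> v" by blast
  then have "(v, x) \<in> \<rho>\<^sup>*" using assms(2,3) by (auto simp: connected_graph_def)
  then show ?thesis using \<open>x \<noteq> v\<close> that by (metis converse_rtranclE)
qed

text \<open>The end nodes of an edge are distinct because loops are excluded, so their distance is
  not 0. Once diameter 1 is ruled out, this leaves diameter at least 2.\<close>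

lemma graph_diameter_pos:
  assumes "simple_graph X \<rho>" "connected_graph X \<rho>"
  shows "graph_diameter X \<rho> \<ge> 1"
proof -
  obtain v where v: "v \<in> X" using assms(1) by (fastforce simp: simple_graph_def)
  obtain w where w: "(v, w) \<in> \<rho>" using connected_graph_neighbour[OF assms v] .
  have ne: "v \<noteq> w" "w \<in> X" "finite X" using w assms(1) by (auto simp: simple_graph_def)
  have "(v, w) \<in> \<rho> ^^ graph_dist \<rho> v w" using w by (intro relpow_graph_dist) auto
  then have "graph_dist \<rho> v w \<noteq> 0" using ne by (metis relpow_0_E)
  then show ?thesis using graph_dist_le_diameter[OF ne(3) v ne(2), of \<rho>] by linarith
qed

section \<open>The sets of walk lengths and their number\<close>

lemma walk_lengths_eq_dist_lengths:
  assumes "simple_graph X \<rho>" "connected_graph X \<rho>" "bipartite_graph X \<rho>"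
    and UV: "U \<subseteq> X" "V \<subseteq> X"
  shows "walk_lengths \<rho> U V = dist_lengths \<rho> U V"
proof (intro equalityI subsetI)
  have d: "(u, v) \<in> \<rho> ^^ graph_dist \<rho> u v" if "u \<in> U" "v \<in> V" for u v
    using that UV assms(2) by (intro relpow_graph_dist) (auto simp: connected_graph_def)
  fix n
  {
    assume "n \<in> walk_lengths \<rho> U V"
    then obtain u v where uv: "n \<ge> 1" "u \<in> U" "v \<in> V" "(u, v) \<in> \<rho> ^^ n"
      by (auto simp: walk_lengths_def)
    obtain A B where AB: "A \<union> B = X" "A \<inter> B = {}" "\<rho> \<subseteq> A \<times> B \<union> B \<times> A"
      using assms(3) by (auto simp: bipartite_graph_def)
    have "u \<in> A \<union> B" using AB uv UV by auto
    \<comment> \<open>The given walk and a shortest one share their end nodes, hence the parity of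
      their lengths.\<close>
    then have "even n = even (graph_dist \<rho> u v)"
      using relpow_bipartite_parity[OF AB(2,3)] d[OF uv(2,3)] uv(4) by blast
    \<comment> \<open>This inequality ensures that the subtraction on \<open>nat\<close> below is
      not truncated.\<close>
    moreover have "graph_dist \<rho> u v \<le> n" using uv(4) by (rule graph_dist_le)
    ultimately have "even (n - graph_dist \<rho> u v)" by simp
    then obtain k where "n - graph_dist \<rho> u v = 2 * k" by (elim evenE)
    then have "n = graph_dist \<rho> u v + 2 * k" using \<open>graph_dist \<rho> u v \<le> n\<close> by linarith
    then show "n \<in> dist_lengths \<rho> U V" using uv by (auto simp: dist_lengths_def)
  next
    assume "n \<in> dist_lengths \<rho> U V"
    then obtain u v k where uv: "n \<ge> 1" "u \<in> U" "v \<in> V" "n = graph_dist \<rho> u v + 2 * k"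
      by (auto simp: dist_lengths_def)
    obtain w where "(v, w) \<in> \<rho>" using connected_graph_neighbour[OF assms(1,2)] UV uv by blast
    then have "(u, v) \<in> \<rho> ^^ n"
      using uv d assms(1) by (auto intro: relpow_add_even simp: simple_graph_def)
    then show "n \<in> walk_lengths \<rho> U V" using uv by (auto simp: walk_lengths_def)
  }
qed

text \<open>Each pair of nodes contributes one progression, starting at its distance or, for equal
  nodes, at 2. The bound on the diameter keeps the start 2 inside the range allowed for
  \<open>M\<close>.\<close>

lemma dist_lengths_eq_Union_progression2:
  assumes "finite X" "U \<subseteq> X" "V \<subseteq> X" "U \<noteq> {}" "V \<noteq> {}" and D: "graph_diameter X \<rho> \<ge> 2"
  shows "\<exists>M \<subseteq> {1..graph_diameter X \<rho>}. M \<noteq> {} \<and>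
    dist_lengths \<rho> U V = (\<Union>m\<in>M. progression2 m)"
proof -
  \<comment> \<open>Distance 0 yields 0, 2, 4, and so on; intersecting with \<open>{1..}\<close>
    drops the 0, so the progression starts at 2.\<close>
  define g where "g u v = (if graph_dist \<rho> u v = 0 then 2 else graph_dist \<rho> u v)" for u v
  define M where "M = (\<lambda>(u, v). g u v) ` (U \<times> V)"
  have g: "{graph_dist \<rho> u v + 2 * k | k. True} \<inter> {1..} = progression2 (g u v)" for u v
  proof (cases "graph_dist \<rho> u v = 0")
    case True
    have "{2 * k | k. True} \<inter> {1..} = progression2 2"
      unfolding progression2_def by (auto; presburger)
    then show ?thesis using True by (simp add: g_def)
  qed (auto simp: g_def progression2_def)
  have "M \<subseteq> {1..graph_diameter X \<rho>}"
  proof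
    fix m assume "m \<in> M"
    then obtain u v where "u \<in> X" "v \<in> X" "m = g u v" using assms(2,3) by (auto simp: M_def)
    then show "m \<in> {1..graph_diameter X \<rho>}"
      using graph_dist_le_diameter[OF assms(1), of u v \<rho>] D by (auto simp: g_def)
  qed
  moreover have "M \<noteq> {}" using assms by (auto simp: M_def)
  moreover have "dist_lengths \<rho> U V =
      (\<Union>u\<in>U. \<Union>v\<in>V. {graph_dist \<rho> u v + 2 * k | k. True} \<inter> {1..})"
    unfolding dist_lengths_def by blast
  then have "dist_lengths \<rho> U V = (\<Union>m\<in>M. progression2 m)"
    unfolding g by (auto simp: M_def)
  ultimately show ?thesis by blast
qed

text \<open>Every open set of \<open>\<tau>\<close> is open in the discrete topology, so one family
  of sets contains the other. The larger family is finite because \<open>X\<close> has finitely many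
  subsets, as monotonicity of \<open>card\<close> requires.\<close>

lemma S_number_le_discrete:
  assumes "finite X" "topspace \<tau> = X"
  shows "S_number \<rho> \<tau> \<le> S_number \<rho> (discrete_topology X)"
proof -
  have "finite ((\<lambda>(U, V). walk_lengths \<rho> U V) ` (Pow X \<times> Pow X))" using assms(1) by simp
  then have "finite {walk_lengths \<rho> U V | U V. openin (discrete_topology X) U \<and> U \<noteq> {} \<and>
      openin (discrete_topology X) V \<and> V \<noteq> {}}"
    by (rule rev_finite_subset) auto
  then show ?thesis
    unfolding S_number_def
  proof (rule card_mono)
    have "openin (discrete_topology X) U" if "openin \<tau> U" for U
      using that assms(2) openin_subset by auto
    then show "{walk_lengths \<rho> U V | U V. openin \<tau> U \<and> U \<noteq> {} \<and> openin \<tau> V \<and> V \<noteq> {}} \<subseteq>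
      {walk_lengths \<rho> U V | U V. openin (discrete_topology X) U \<and> U \<noteq> {} \<and>
        openin (discrete_topology X) V \<and> V \<noteq> {}}"
      by blast
  qed
qed

text \<open>Diameter 1 is excluded from the last bound because it fails there: the graph is then a
  single edge, whose sets of walk lengths are the even, the odd and all positive integers. These are
  3 sets, while the bound is 5/4, since the odd numbers in the indicator start at 3.\<close>

theorem theorem3p7:
  fixes X :: "'a set" and \<rho> :: "('a \<times> 'a) set" and \<tau> :: "'a topology"
  assumes "simple_graph X \<rho>"
    and "connected_graph X \<rho>"
    and "bipartite_graph X \<rho>"
    and "topspace \<tau> = X"
  shows "(\<forall>U V. openin \<tau> U \<and> U \<noteq> {} \<and> openin \<tau> V \<and> V \<noteq> {} \<longrightarrow>
            walk_lengths \<rho> U V = dist_lengths \<rho> U V) \<and>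
         S_number \<rho> \<tau> \<le> S_number \<rho> (discrete_topology X) \<and>
         (graph_diameter X \<rho> \<noteq> 1 \<longrightarrow>
            real (S_number \<rho> (discrete_topology X)) \<le>
              real (graph_diameter X \<rho>) + (real (graph_diameter X \<rho>))\<^sup>2 / 4
              - 1 / 4 * indicator {2 * n + 1 | n. n \<ge> 1} (graph_diameter X \<rho>))"
proof (intro conjI allI impI)
  have fin: "finite X" using assms(1) by (simp add: simple_graph_def)
  show "walk_lengths \<rho> U V = dist_lengths \<rho> U V"
    if "openin \<tau> U \<and> U \<noteq> {} \<and> openin \<tau> V \<and> V \<noteq> {}" for U V
    using that openin_subset assms(4)
    by (intro walk_lengths_eq_dist_lengths[OF assms(1-3)]) blast+
  show "S_number \<rho> \<tau> \<le> S_number \<rho> (discrete_topology X)"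
    using fin assms(4) by (rule S_number_le_discrete)
  define D where "D = graph_diameter X \<rho>"
  assume "graph_diameter X \<rho> \<noteq> 1"
  then have D: "D \<ge> 2" using graph_diameter_pos[OF assms(1,2)] by (simp add: D_def)
  have "S_number \<rho> (discrete_topology X) \<le> D + (D div 2) * ((D + 1) div 2)"
    unfolding S_number_def
  proof (rule card_Union_progression2_le)
    fix W
    assume "W \<in> {walk_lengths \<rho> U V | U V. openin (discrete_topology X) U \<and> U \<noteq> {} \<and>
      openin (discrete_topology X) V \<and> V \<noteq> {}}"
    then obtain U V where UV: "U \<subseteq> X" "V \<subseteq> X" "U \<noteq> {}" "V \<noteq> {}" and W: "W = walk_lengths \<rho> U V"
      by auto
    show "\<exists>M \<subseteq> {1..D}. M \<noteq> {} \<and> W = (\<Union>m\<in>M. progression2 m)"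
      using dist_lengths_eq_Union_progression2[OF fin UV, of \<rho>] D
      unfolding W D_def walk_lengths_eq_dist_lengths[OF assms(1-3) UV(1,2)] by blast
  qed
  then have le: "real (S_number \<rho> (discrete_topology X)) \<le> real (D + (D div 2) * ((D + 1) div 2))"
    by (rule of_nat_mono)
  \<comment> \<open>The product is \<open>m * m\<close> for \<open>D = 2 * m\<close>, which is a
    quarter of the square of \<open>D\<close>, and \<open>m * (m + 1)\<close> for
    \<open>D = 2 * m + 1\<close>, which is smaller than that quarter by 1/4.\<close>
  have "real (D + (D div 2) * ((D + 1) div 2)) =
      real D + (real D)\<^sup>2 / 4 - 1 / 4 * indicator {2 * n + 1 | n. n \<ge> 1} D"
  proof (cases "even D")
    case True
    then obtain m where m: "D = 2 * m" by (elim evenE)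
    then have "D \<notin> {2 * n + 1 | n. n \<ge> 1}" by (auto simp: mult_2) presburger
    moreover have "(D div 2) * ((D + 1) div 2) = m * m" using m by simp
    ultimately show ?thesis using m by (simp add: power2_eq_square)
  next
    case False
    then obtain m where m: "D = 2 * m + 1" by (elim oddE)
    \<comment> \<open>Here \<open>D \<ge> 2\<close> gives \<open>m \<ge> 1\<close>, as membership in
      the indicator set demands.\<close>
    then have "D \<in> {2 * n + 1 | n. n \<ge> 1}" using D by auto
    moreover have "(D div 2) * ((D + 1) div 2) = m * (m + 1)" using m by simp
    ultimately show ?thesis using m by (simp add: power2_eq_square field_simps)
  qed
  with le show "real (S_number \<rho> (discrete_topology X)) \<le>
      real (graph_diameter X \<rho>) + (real (graph_diameter X \<rho>))\<^sup>2 / 4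
      - 1 / 4 * indicator {2 * n + 1 | n. n \<ge> 1} (graph_diameter X \<rho>)"
    unfolding D_def by linarith
qed

end
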